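(* Let $G$ be a finite graph with average degree $d\ge 2$ and second order average degree $\widetilde{d}$, and let $w_0(uv)=(d(u)d(v))^{-1/2}$ for every edge $uv$ of $G$. Then for every natural number $r\ge 1$ there exists a vertex $v$ of $G$ such that $$\lambda_1(G(v,r),w_0)\ge \frac{2\sqrt{d-1}}{\widetilde{d}}\cos\left(\frac{\pi}{r+2}\right).$$
   Context: $d(u)$ denotes the degree of $u$ in $G$. The average degree of $G$ is $\sum_u d(u)/|V(G)|$ and its second order average degree is $\widetilde{d}=\sum_{u}d(u)^2/\sum_u d(u)$. The ball $G(v,r)$ is the subgraph of $G$ induced on vertices at distance at most $r$ from $v$, with the restricted weight $w_0$ (degrees in $w_0$ are always taken in $G$). $\lambda_1(H,w)$ denotes the spectral radius of the weighted adjacency matrix of $(H,w)$ (entry $w(uv)$ if $uv$ is an edge, $0$ otherwise). *)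

theory Defs
  imports "HOL-Analysis.Analysis"
begin

definition finite_graph :: "'a set \<Rightarrow> ('a \<Rightarrow> 'a \<Rightarrow> bool) \<Rightarrow> bool" where
  "finite_graph V E \<longleftrightarrow> finite V \<and> (\<forall>u v. E u v \<longrightarrow> u \<in> V \<and> v \<in> V)
     \<and> (\<forall>u v. E u v \<longrightarrow> E v u) \<and> (\<forall>u. \<not> E u u)"

definition degree :: "'a set \<Rightarrow> ('a \<Rightarrow> 'a \<Rightarrow> bool) \<Rightarrow> 'a \<Rightarrow> nat" where
  "degree V E u = card {v \<in> V. E u v}"

definition avg_degree :: "'a set \<Rightarrow> ('a \<Rightarrow> 'a \<Rightarrow> bool) \<Rightarrow> real" where
  "avg_degree V E = (\<Sum>u\<in>V. real (degree V E u)) / real (card V)"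

definition second_avg_degree :: "'a set \<Rightarrow> ('a \<Rightarrow> 'a \<Rightarrow> bool) \<Rightarrow> real" where
  "second_avg_degree V E =
     (\<Sum>u\<in>V. real (degree V E u) ^ 2) / (\<Sum>u\<in>V. real (degree V E u))"

definition w0 :: "'a set \<Rightarrow> ('a \<Rightarrow> 'a \<Rightarrow> bool) \<Rightarrow> 'a \<Rightarrow> 'a \<Rightarrow> real" where
  "w0 V E u v = 1 / sqrt (real (degree V E u) * real (degree V E v))"

fun within_dist :: "('a \<Rightarrow> 'a \<Rightarrow> bool) \<Rightarrow> 'a \<Rightarrow> nat \<Rightarrow> 'a \<Rightarrow> bool" where
  "within_dist E v 0 u = (u = v)"
| "within_dist E v (Suc k) u = (within_dist E v k u \<or> (\<exists>y. within_dist E v k y \<and> E y u))"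

definition ball_vertices :: "'a set \<Rightarrow> ('a \<Rightarrow> 'a \<Rightarrow> bool) \<Rightarrow> 'a \<Rightarrow> nat \<Rightarrow> 'a set" where
  "ball_vertices V E v r = {u \<in> V. within_dist E v r u}"

definition ball_edges :: "'a set \<Rightarrow> ('a \<Rightarrow> 'a \<Rightarrow> bool) \<Rightarrow> 'a \<Rightarrow> nat \<Rightarrow> 'a \<Rightarrow> 'a \<Rightarrow> bool" where
  "ball_edges V E v r x y \<longleftrightarrow> E x y \<and> x \<in> ball_vertices V E v r \<and> y \<in> ball_vertices V E v r"

definition wadj_eigenvalue :: "'a set \<Rightarrow> ('a \<Rightarrow> 'a \<Rightarrow> bool) \<Rightarrow> ('a \<Rightarrow> 'a \<Rightarrow> real) \<Rightarrow> complex \<Rightarrow> bool" where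
  "wadj_eigenvalue W F w \<mu> \<longleftrightarrow>
     (\<exists>x :: 'a \<Rightarrow> complex. (\<exists>v\<in>W. x v \<noteq> 0) \<and>
        (\<forall>v\<in>W. (\<Sum>u\<in>W. (if F v u then complex_of_real (w v u) else 0) * x u) = \<mu> * x v))"

definition spectral_radius_w :: "'a set \<Rightarrow> ('a \<Rightarrow> 'a \<Rightarrow> bool) \<Rightarrow> ('a \<Rightarrow> 'a \<Rightarrow> real) \<Rightarrow> real" where
  "spectral_radius_w W F w = Max {cmod \<mu> | \<mu>. wadj_eigenvalue W F w \<mu>}"

end

theory Submission
  imports Defs "Jordan_Normal_Form.Spectral_Radius"
begin

text \<open>
  Suppose that the spectral radius of every ball of radius \<open>r\<close> is less than \<open>\<lambda>\<close>. A ball then has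
  a positive function \<open>h\<close> with \<open>A h < \<lambda> h\<close>, and \<open>g = h / \<surd>d\<close> satisfies
  \<open>\<Sum>\<^bsub>z ~ x\<^esub> g(z) < \<lambda> d(x) g(x)\<close>. The functions \<open>g\<close> depend on the ball, but their ratios along edges
  dominate the numbers \<open>m\<^sub>k(x, y)\<close>, \<open>k \<le> r\<close>, given by \<open>m\<^sub>0 = 0\<close> and
  \<open>\<lambda> d(y) = 1 / m\<^bsub>k+1\<^esub>(x, y) + \<Sum>\<^bsub>z ~ y, z \<noteq> x\<^esub> m\<^sub>k(y, z)\<close>, which therefore are positive, and
  \<open>\<lambda> d(v) > \<Sum>\<^bsub>z ~ v\<^esub> m\<^sub>r(v, z)\<close>. Summing the recursion over all directed edges gives
  \<open>\<lambda> \<Sum> d\<^sup>2 = \<Sum>\<^bsub>xy\<^esub> (1 / m\<^bsub>k+1\<^esub>(x, y) + (d(x) - 1) m\<^sub>k(x, y))\<close>. Weighting these identities with the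
  squares of the Perron eigenvector of a path with \<open>r + 1\<close> vertices and applying the inequality of
  the arithmetic and geometric mean to the two terms with the same \<open>k\<close> yields
  \<open>\<lambda> \<Sum> d\<^sup>2 > 2 cos (\<pi> / (r + 2)) \<Sum> d \<surd>(d - 1)\<close>. Finally, \<open>x \<surd>(x - 1)\<close> lies above its tangent at any
  point \<open>\<ge> 2\<close>; the condition \<open>\<ge> 2\<close> is what makes this true at \<open>x = 1\<close>, that is, for leaves.
\<close>

unbundle no vec_syntax

section \<open>Spectral radius and positive supersolutions\<close>

text \<open>Bridge from eigenfunctions on a vertex set to matrices indexed by numbers, which makes
  the bound on matrix powers from Jordan normal forms applicable.\<close>

lemma wadj_eigenvalue_iff_eigenvalue:
  fixes idx :: "nat \<Rightarrow> 'a" and F :: "'a \<Rightarrow> 'a \<Rightarrow> bool" and w :: "'a \<Rightarrow> 'a \<Rightarrow> real"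
  assumes idx: "bij_betw idx {0..<n} W"
  defines "A \<equiv> Matrix.mat n n (\<lambda>(i, j). if F (idx i) (idx j) then complex_of_real (w (idx i) (idx j)) else 0)"
  shows "wadj_eigenvalue W F w \<mu> \<longleftrightarrow> eigenvalue A \<mu>"
proof -
  have dim: "dim_row A = n" "dim_col A = n" by (auto simp: A_def)
  have mult: "(A *\<^sub>v Matrix.vec n (\<lambda>i. x (idx i))) $ i =
      (\<Sum>u\<in>W. (if F (idx i) u then complex_of_real (w (idx i) u) else 0) * x u)"
    if i: "i < n" for x :: "'a \<Rightarrow> complex" and i
  proof -
    have "(A *\<^sub>v Matrix.vec n (\<lambda>i. x (idx i))) $ i = (\<Sum>j = 0..<n.
        (if F (idx i) (idx j) then complex_of_real (w (idx i) (idx j)) else 0) * x (idx j))"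
      using i by (simp add: A_def scalar_prod_def)
    also have "\<dots> = (\<Sum>u\<in>W. (if F (idx i) u then complex_of_real (w (idx i) u) else 0) * x u)"
      by (rule sum.reindex_bij_betw[OF idx])
    finally show ?thesis .
  qed
  have W: "(\<forall>v\<in>W. P v) \<longleftrightarrow> (\<forall>i<n. P (idx i))" for P
    unfolding bij_betw_imp_surj_on[OF idx, symmetric] by auto
  have ev: "eigenvector A (Matrix.vec n (\<lambda>i. x (idx i))) \<mu> \<longleftrightarrow>
      (\<exists>v\<in>W. x v \<noteq> 0) \<and>
      (\<forall>v\<in>W. (\<Sum>u\<in>W. (if F v u then complex_of_real (w v u) else 0) * x u) = \<mu> * x v)"
    for x :: "'a \<Rightarrow> complex"
  proof -
    have "Matrix.vec n (\<lambda>i. x (idx i)) \<noteq> 0\<^sub>v n \<longleftrightarrow> (\<exists>v\<in>W. x v \<noteq> 0)"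
      using W[of "\<lambda>v. x v = 0"] by (auto simp: Matrix.vec_eq_iff)
    moreover have "A *\<^sub>v Matrix.vec n (\<lambda>i. x (idx i)) = \<mu> \<cdot>\<^sub>v Matrix.vec n (\<lambda>i. x (idx i)) \<longleftrightarrow>
      (\<forall>v\<in>W. (\<Sum>u\<in>W. (if F v u then complex_of_real (w v u) else 0) * x u) = \<mu> * x v)"
      unfolding W by (subst Matrix.vec_eq_iff) (simp add: dim mult del: index_mult_mat_vec)
    ultimately show ?thesis
      by (simp add: eigenvector_def dim)
  qed
  show ?thesis
  proof
    assume "wadj_eigenvalue W F w \<mu>"
    then obtain x where "(\<exists>v\<in>W. x v \<noteq> 0) \<and>
        (\<forall>v\<in>W. (\<Sum>u\<in>W. (if F v u then complex_of_real (w v u) else 0) * x u) = \<mu> * x v)"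
      unfolding wadj_eigenvalue_def by (elim exE)
    then have "eigenvector A (Matrix.vec n (\<lambda>i. x (idx i))) \<mu>"
      by (rule iffD2[OF ev])
    then show "eigenvalue A \<mu>"
      unfolding eigenvalue_def by (rule exI)
  next
    assume "eigenvalue A \<mu>"
    then obtain y where y: "eigenvector A y \<mu>"
      by (auto simp: eigenvalue_def)
    define x where "x u = y $ inv_into {0..<n} idx u" for u
    have "dim_vec y = n"
      using y by (simp add: eigenvector_def dim)
    then have "y = Matrix.vec n (\<lambda>i. x (idx i))"
      by (intro eq_vecI) (simp_all add: x_def inv_into_f_f[OF bij_betw_imp_inj_on[OF idx]])
    with y have "eigenvector A (Matrix.vec n (\<lambda>i. x (idx i))) \<mu>" by simp
    then show "wadj_eigenvalue W F w \<mu>"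
      unfolding wadj_eigenvalue_def ev by (rule exI[of _ x])
  qed
qed

lemma spectral_radius_w_eq_spectral_radius:
  fixes idx :: "nat \<Rightarrow> 'a"
  assumes idx: "bij_betw idx {0..<n} W"
  shows "spectral_radius_w W F w = spectral_radius
    (Matrix.mat n n (\<lambda>(i, j). if F (idx i) (idx j) then complex_of_real (w (idx i) (idx j)) else 0))"
  unfolding spectral_radius_w_def spectral_radius_def spectrum_def
    wadj_eigenvalue_iff_eigenvalue[OF idx]
  by (simp add: setcompr_eq_image)

lemma spectral_radius_smult_less_1:
  fixes A :: "complex mat"
  assumes A: "A \<in> carrier_mat n n" and n: "n > 0"
    and \<mu>: "spectral_radius A < \<mu>" "\<mu> > 0"
  shows "spectral_radius (complex_of_real (1 / \<mu>) \<cdot>\<^sub>m A) < 1"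
proof -
  let ?B = "complex_of_real (1 / \<mu>) \<cdot>\<^sub>m A"
  have B: "?B \<in> carrier_mat n n" using A by simp
  obtain k where k: "eigenvalue ?B k" "spectral_radius ?B = norm k"
    using spectral_radius_mem_max(1)[OF B n] by (auto simp: spectrum_def)
  then obtain y where y: "y \<in> carrier_vec n" "y \<noteq> 0\<^sub>v n" "?B *\<^sub>v y = k \<cdot>\<^sub>v y"
    using A by (auto simp: eigenvalue_def eigenvector_def)
  have "complex_of_real (1 / \<mu>) \<cdot>\<^sub>v (A *\<^sub>v y) = k \<cdot>\<^sub>v y"
    using y(3)[symmetric] y(1) A by (auto intro!: eq_vecI simp: scalar_prod_def sum_distrib_left mult.assoc)
  then have "complex_of_real \<mu> \<cdot>\<^sub>v (complex_of_real (1 / \<mu>) \<cdot>\<^sub>v (A *\<^sub>v y)) =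
      (complex_of_real \<mu> * k) \<cdot>\<^sub>v y"
    by (simp add: smult_smult_assoc)
  then have "A *\<^sub>v y = (complex_of_real \<mu> * k) \<cdot>\<^sub>v y"
    using \<mu>(2) by (simp add: smult_smult_assoc)
  then have "eigenvalue A (complex_of_real \<mu> * k)"
    using y A by (auto simp: eigenvalue_def eigenvector_def)
  then have "norm (complex_of_real \<mu> * k) \<le> spectral_radius A"
    by (intro spectral_radius_mem_max(2)[OF A n]) (auto simp: spectrum_def)
  then have "norm k \<le> spectral_radius A / \<mu>"
    using \<mu>(2) by (simp add: norm_mult field_simps)
  also have "\<dots> < 1"
    using \<mu> by simp
  finally show ?thesis
    using k(2) by simp
qed

text \<open>\<open>p k\<close> is the \<open>k\<close>-th power of the weighted adjacency matrix
  applied to the all-ones vector. Divided by \<open>\<mu>\<close>, the matrix has spectral radius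
  below 1, so the entries of its powers are uniformly bounded, and \<open>p k v / \<mu> ^ k\<close>
  is a row sum of such a power.\<close>

lemma iterate_ones_geometric_bound:
  fixes W :: "'a set" and F :: "'a \<Rightarrow> 'a \<Rightarrow> bool" and w :: "'a \<Rightarrow> 'a \<Rightarrow> real"
    and p :: "nat \<Rightarrow> 'a \<Rightarrow> real"
  assumes W: "finite W" "W \<noteq> {}"
    and \<mu>: "spectral_radius_w W F w < \<mu>" "\<mu> > 0"
    and p0: "\<And>v. v \<in> W \<Longrightarrow> p 0 v = 1"
    and pSuc: "\<And>k v. v \<in> W \<Longrightarrow> p (Suc k) v = (\<Sum>u\<in>W. (if F v u then w v u else 0) * p k u)"
  shows "\<exists>C. \<forall>k. \<forall>v\<in>W. \<bar>p k v\<bar> \<le> C * \<mu> ^ k"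
proof -
  define n where "n = card W"
  have n: "n > 0" using W by (simp add: n_def card_gt_0_iff)
  obtain idx where idx: "bij_betw idx {0..<n} W"
    using ex_bij_betw_nat_finite[OF W(1)] n_def by blast
  define A where "A = Matrix.mat n n (\<lambda>(i, j). if F (idx i) (idx j)
    then complex_of_real (w (idx i) (idx j)) else 0)"
  define B where "B = complex_of_real (1 / \<mu>) \<cdot>\<^sub>m A"
  have A: "A \<in> carrier_mat n n" by (simp add: A_def)
  then have B: "B \<in> carrier_mat n n" by (simp add: B_def)
  have "spectral_radius A < \<mu>"
    using \<mu>(1) spectral_radius_w_eq_spectral_radius[OF idx, of F w] by (simp add: A_def)
  then have "spectral_radius B < 1"
    unfolding B_def using spectral_radius_smult_less_1[OF A n] \<mu>(2) by blast
  then obtain c where c: "\<And>k. norm_bound (B ^\<^sub>m k) c"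
    using spectral_radius_jnf_norm_bound_less_1_upper_triangular[OF B] by blast
  define q where "q k = Matrix.vec n (\<lambda>i. complex_of_real (p k (idx i) / \<mu> ^ k))" for k
  have idxW: "idx i \<in> W" if "i < n" for i
    using idx that by (auto simp: bij_betw_def)
  have qSuc: "q (Suc k) = B *\<^sub>v q k" for k
  proof (rule eq_vecI)
    show "dim_vec (q (Suc k)) = dim_vec (B *\<^sub>v q k)"
      using B by (simp add: q_def)
    fix i assume "i < dim_vec (B *\<^sub>v q k)"
    then have i: "i < n" using B by simp
    have "p (Suc k) (idx i) =
        (\<Sum>j = 0..<n. (if F (idx i) (idx j) then w (idx i) (idx j) else 0) * p k (idx j))"
      unfolding pSuc[OF idxW[OF i]] by (rule sum.reindex_bij_betw[OF idx, symmetric])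
    then have "q (Suc k) $ i = complex_of_real
        (\<Sum>j = 0..<n. (if F (idx i) (idx j) then w (idx i) (idx j) else 0) * p k (idx j)) /
        complex_of_real (\<mu> ^ Suc k)"
      using i by (simp add: q_def)
    also have "\<dots> = (\<Sum>j = 0..<n. B $$ (i, j) * q k $ j)"
      unfolding of_real_sum sum_divide_distrib
      using i by (intro sum.cong) (auto simp: q_def B_def A_def)
    also have "\<dots> = (B *\<^sub>v q k) $ i"
      using i B by (simp add: scalar_prod_def q_def)
    finally show "q (Suc k) $ i = (B *\<^sub>v q k) $ i" .
  qed
  \<comment> \<open>The power \<open>B ^\<^sub>m Suc k\<close> unfolds with the new factor on the
    right, so the induction has to absorb it into \<open>j\<close>.\<close>
  have q': "q (k + j) = B ^\<^sub>m k *\<^sub>v q j" for k j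
  proof (induction k arbitrary: j)
    case 0
    have "q j \<in> carrier_vec n" by (simp add: q_def)
    then show ?case using B by simp
  next
    case (Suc k)
    have "q j \<in> carrier_vec n" by (simp add: q_def)
    then show ?case
      using Suc[of "Suc j"] qSuc[of j] B by (simp add: assoc_mult_mat_vec[of _ n n _ n])
  qed
  have q: "q k = B ^\<^sub>m k *\<^sub>v q 0" for k
    using q'[of k 0] by simp
  show ?thesis
  proof (intro exI allI ballI)
    fix k v assume "v \<in> W"
    then obtain i where i: "i < n" "v = idx i"
      using idx by (auto simp: bij_betw_def)
    have Bk: "B ^\<^sub>m k \<in> carrier_mat n n" using B by (simp add: pow_carrier_mat)
    have "norm (q k $ i) = norm (\<Sum>j = 0..<n. (B ^\<^sub>m k) $$ (i, j))"
      using i carrier_matD[OF Bk] p0 idxW by (subst q) (simp add: q_def scalar_prod_def)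
    also have "\<dots> \<le> (\<Sum>j = 0..<n. norm ((B ^\<^sub>m k) $$ (i, j)))"
      by (rule norm_sum)
    also have "\<dots> \<le> (\<Sum>j = 0..<n. c)"
      using c[of k] i(1) unfolding norm_bound_def carrier_matD[OF Bk]
      by (intro sum_mono) auto
    finally have "\<bar>p k v\<bar> / \<mu> ^ k \<le> n * c"
      using i \<mu>(2) by (simp add: q_def norm_divide norm_power)
    then show "\<bar>p k v\<bar> \<le> (n * c) * \<mu> ^ k"
      using \<mu>(2) by (simp add: field_simps)
  qed
qed

text \<open>The witness is a truncated Neumann series of \<open>(1 - A / \<lambda>)\<^sup>-\<^sup>1\<close> applied to the all-ones vector.\<close>

lemma positive_supersolution_exists:
  fixes W :: "'a set" and F :: "'a \<Rightarrow> 'a \<Rightarrow> bool" and w :: "'a \<Rightarrow> 'a \<Rightarrow> real"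
  assumes W: "finite W"
    and w: "\<And>u v. w u v \<ge> 0"
    and l: "spectral_radius_w W F w < l" "l > 0"
  shows "\<exists>h. (\<forall>v\<in>W. h v > 0) \<and>
    (\<forall>v\<in>W. (\<Sum>u\<in>W. (if F v u then w v u else 0) * h u) < l * h v)"
proof (cases "W = {}")
  case False
  define a where "a v u = (if F v u then w v u else 0)" for v u
  have a: "a v u \<ge> 0" for v u using w by (simp add: a_def)
  define p where "p k = ((\<lambda>f v. \<Sum>u\<in>W. a v u * f u) ^^ k) (\<lambda>_. 1)" for k
  have p0: "p 0 v = 1" and pSuc: "p (Suc k) v = (\<Sum>u\<in>W. a v u * p k u)" for k v
    by (simp_all add: p_def)
  have p: "p k v \<ge> 0" for k v
    by (induction k arbitrary: v) (auto simp: p0 pSuc intro!: sum_nonneg mult_nonneg_nonneg a)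
  \<comment> \<open>The gap between \<open>m\<close> and \<open>l\<close> makes
    \<open>p k v / l ^ k\<close> decay geometrically.\<close>
  obtain m where m: "max 0 (spectral_radius_w W F w) < m" "m < l"
    using dense[of "max 0 (spectral_radius_w W F w)" l] l by auto
  have "\<exists>C. \<forall>k. \<forall>v\<in>W. \<bar>p k v\<bar> \<le> C * m ^ k"
    by (rule iterate_ones_geometric_bound[OF W False]) (use m in \<open>auto simp: p0 pSuc a_def\<close>)
  then obtain C where C: "\<And>k v. v \<in> W \<Longrightarrow> \<bar>p k v\<bar> \<le> C * m ^ k"
    by blast
  have "(\<lambda>k. C * (m / l) ^ k) \<longlonglongrightarrow> C * 0"
    using m l by (intro tendsto_mult tendsto_const LIMSEQ_realpow_zero) auto
  then have "eventually (\<lambda>k. C * (m / l) ^ k < 1 \<and> k > 0) sequentially"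
    by (intro eventually_conj order_tendstoD(2) eventually_gt_at_top) auto
  then obtain K where K: "C * (m / l) ^ K < 1" "K > 0"
    by (auto simp: eventually_sequentially)
  define h where "h v = (\<Sum>k<K. p k v / l ^ k)" for v
  have h: "h v > 0" for v
  proof -
    have "p 0 v / l ^ 0 \<le> h v"
      unfolding h_def using K p l by (intro member_le_sum) auto
    then show ?thesis by (simp add: p0)
  qed
  have "(\<Sum>u\<in>W. a v u * h u) < l * h v" if v: "v \<in> W" for v
  proof -
    have "(\<Sum>u\<in>W. a v u * h u) = (\<Sum>k<K. (\<Sum>u\<in>W. a v u * p k u) / l ^ k)"
      unfolding h_def sum_distrib_left sum_divide_distrib by (subst sum.swap) simp
    also have "\<dots> = (\<Sum>k<K. l * (p (Suc k) v / l ^ Suc k))"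
      using l by (intro sum.cong) (auto simp: pSuc)
    also have "\<dots> = l * (\<Sum>k<K. p (Suc k) v / l ^ Suc k)"
      by (rule sum_distrib_left[symmetric])
    \<comment> \<open>Shifting the truncated series drops its first term 1 and adds the term of
      index \<open>K\<close>, which is below 1 by the choice of \<open>K\<close>; hence
      strictness.\<close>
    also have "(\<Sum>k<K. p (Suc k) v / l ^ Suc k) = (\<Sum>k<Suc K. p k v / l ^ k) - p 0 v / l ^ 0"
      by (subst sum.lessThan_Suc_shift) simp
    also have "\<dots> = h v + p K v / l ^ K - 1"
      by (simp add: h_def p0)
    also have "p K v / l ^ K < 1"
    proof -
      have "p K v / l ^ K \<le> C * m ^ K / l ^ K"
        using C[OF v, of K] l by (intro divide_right_mono) auto
      then show ?thesis using K by (simp add: power_divide)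
    qed
    finally show ?thesis using l by simp
  qed
  with h show ?thesis unfolding a_def by blast
qed auto

section \<open>Inequalities for degrees and path weights\<close>

text \<open>The slope \<open>s + a / (2 * s)\<close> is the derivative at \<open>a\<close>. With
  \<open>x = t^2 + 1\<close> and \<open>a = s^2 + 1\<close>, the difference of the two sides times
  \<open>2 * s\<close> factors as \<open>(t - s)^2 * (2 * s * t + (s^2 - 1))\<close>, where
  \<open>s \<ge> 1\<close>.\<close>

lemma tangent_line_mult_sqrt_pred:
  fixes x :: nat and a :: real
  assumes a: "a \<ge> 2"
  defines "s \<equiv> sqrt (a - 1)"
  shows "real x * sqrt (real x - 1) \<ge> a * s + (real x - a) * (s + a / (2 * s))"
proof -
  have s: "s \<ge> 1" and as: "a = s\<^sup>2 + 1"
    using a by (auto simp: s_def)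
  \<comment> \<open>The substitution \<open>x = t^2 + 1\<close> requires \<open>x \<ge> 1\<close>.
    At \<open>x = 0\<close> the tangent has the negative value
    \<open>- a^2 / (2 * s)\<close>.\<close>
  show ?thesis
  proof (cases "x = 0")
    case True
    then show ?thesis using a s by (simp add: algebra_simps)
  next
    case False
    define t where "t = sqrt (real x - 1)"
    have t: "t \<ge> 0" and xt: "real x = t\<^sup>2 + 1"
      using False by (auto simp: t_def)
    have "2 * s * (real x * t - (a * s + (real x - a) * (s + a / (2 * s)))) =
        2 * s * (real x * t) - 2 * s * (a * s) - (real x - a) * (2 * s * s + a)"
      using s by (simp add: field_simps)
    also have "\<dots> = (t - s)\<^sup>2 * (2 * s * t + (s\<^sup>2 - 1))"
      unfolding xt as by (simp add: power2_eq_square algebra_simps)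
    also have "\<dots> \<ge> 0"
      using s t by (intro mult_nonneg_nonneg add_nonneg_nonneg) auto
    finally show ?thesis
      using s by (simp add: zero_le_mult_iff flip: t_def)
  qed
qed

text \<open>Jensen's inequality through the tangent at the mean \<open>a\<close>: the linear parts
  sum to 0.\<close>

lemma sum_mult_sqrt_pred_ge:
  fixes f :: "'a \<Rightarrow> nat" and a :: real
  assumes V: "finite V" "V \<noteq> {}"
    and a: "a = (\<Sum>u\<in>V. real (f u)) / card V" "a \<ge> 2"
  shows "(\<Sum>u\<in>V. real (f u) * sqrt (real (f u) - 1)) \<ge> (\<Sum>u\<in>V. real (f u)) * sqrt (a - 1)"
proof -
  define s where "s = sqrt (a - 1)"
  have M: "(\<Sum>u\<in>V. real (f u)) = card V * a"
    using a(1) V by simp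
  have "(\<Sum>u\<in>V. real (f u)) * s =
      (\<Sum>u\<in>V. a * s + (real (f u) - a) * (s + a / (2 * s)))"
    by (simp add: sum.distrib sum_subtractf M flip: sum_distrib_right)
  also have "\<dots> \<le> (\<Sum>u\<in>V. real (f u) * sqrt (real (f u) - 1))"
    unfolding s_def by (intro sum_mono tangent_line_mult_sqrt_pred a(2))
  finally show ?thesis by (simp add: s_def)
qed

text \<open>\<open>sin ((k + 1) \<theta>)\<close>, \<open>k \<le> r\<close>, is the Perron eigenvector of the path with \<open>r + 1\<close> vertices.\<close>

lemma sum_sin_consecutive:
  fixes r :: nat
  defines "\<theta> \<equiv> pi / (real r + 2)"
  defines "t \<equiv> \<lambda>k::nat. sin (real k * \<theta>)"
  shows "(\<Sum>k<r. 2 * t (Suc k) * t (Suc (Suc k))) = 2 * cos \<theta> * (\<Sum>k\<le>r. (t (Suc k))\<^sup>2)"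
proof -
  have rec: "2 * cos \<theta> * t (Suc k) = t k + t (Suc (Suc k))" for k
  proof -
    have "t k = sin (real (Suc k) * \<theta> - \<theta>)" "t (Suc (Suc k)) = sin (real (Suc k) * \<theta> + \<theta>)"
      by (simp_all add: t_def algebra_simps)
    then show ?thesis unfolding sin_diff sin_add by (simp add: t_def)
  qed
  \<comment> \<open>The angle makes the eigenvector vanish at the positions 0 and
    \<open>r + 2\<close> just beyond the ends of the path.\<close>
  have t0: "t 0 = 0" by (simp add: t_def)
  have "real (Suc (Suc r)) * \<theta> = pi" by (simp add: \<theta>_def add.commute)
  then have tr: "t (Suc (Suc r)) = 0" unfolding t_def by simp
  have "2 * cos \<theta> * (\<Sum>k\<le>r. (t (Suc k))\<^sup>2) = (\<Sum>k\<le>r. t (Suc k) * (2 * cos \<theta> * t (Suc k)))"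
    by (simp add: sum_distrib_left power2_eq_square mult_ac)
  also have "\<dots> = (\<Sum>k\<le>r. t k * t (Suc k)) + (\<Sum>k\<le>r. t (Suc k) * t (Suc (Suc k)))"
    unfolding rec by (simp add: algebra_simps sum.distrib)
  also have "(\<Sum>k\<le>r. t k * t (Suc k)) = (\<Sum>k<r. t (Suc k) * t (Suc (Suc k)))"
    by (subst lessThan_Suc_atMost[symmetric], subst sum.lessThan_Suc_shift) (simp add: t0)
  also have "(\<Sum>k\<le>r. t (Suc k) * t (Suc (Suc k))) = (\<Sum>k<r. t (Suc k) * t (Suc (Suc k)))"
    by (subst lessThan_Suc_atMost[symmetric]) (simp add: tr)
  finally show ?thesis by (simp add: sum_distrib_left mult.assoc)
qed

text \<open>Expansion of a square. It is applied with an edge ratio \<open>m\<close> and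
  \<open>D = d x - 1\<close>, so that \<open>m\<close> cancels in the product of the two
  terms.\<close>

lemma weighted_am_gm:
  fixes m :: real
  assumes "m > 0" "D \<ge> 0"
  shows "2 * a * b * sqrt D \<le> a\<^sup>2 / m + b\<^sup>2 * (D * m)"
proof -
  have "0 \<le> (a / sqrt m - b * sqrt D * sqrt m)\<^sup>2" by simp
  also have "\<dots> = a\<^sup>2 / m + b\<^sup>2 * (D * m) - 2 * (a / sqrt m * (b * sqrt D * sqrt m))"
    using assms by (simp add: power2_diff power_mult_distrib power_divide)
  also have "a / sqrt m * (b * sqrt D * sqrt m) = a * b * sqrt D"
    using assms by simp
  finally show ?thesis by simp
qed

text \<open>Each \<open>z\<close> is left out for exactly one \<open>x\<close>. This is the source
  of the factor \<open>d x - 1\<close>.\<close>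

lemma sum_sum_remove1:
  fixes f :: "'a \<Rightarrow> real"
  assumes "finite A"
  shows "(\<Sum>x\<in>A. \<Sum>z\<in>A - {x}. f z) = (real (card A) - 1) * (\<Sum>z\<in>A. f z)"
proof -
  have "(\<Sum>x\<in>A. \<Sum>z\<in>A - {x}. f z) = (\<Sum>x\<in>A. (\<Sum>z\<in>A. f z) - f x)"
    using assms by (intro sum.cong) (auto simp: sum_diff1)
  then show ?thesis by (simp add: sum_subtractf algebra_simps)
qed

section \<open>Supersolutions on balls and edge ratios\<close>

lemma within_dist_mono: "within_dist E v k u \<Longrightarrow> k \<le> j \<Longrightarrow> within_dist E v j u"
  by (induction j) (auto simp: le_Suc_eq)

lemma within_dist_step: "within_dist E v k x \<Longrightarrow> E x y \<Longrightarrow> within_dist E v (Suc k) y"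
  by auto

definition neighbours :: "'a set \<Rightarrow> ('a \<Rightarrow> 'a \<Rightarrow> bool) \<Rightarrow> 'a \<Rightarrow> 'a set" where
  "neighbours V E u = {v \<in> V. E u v}"

lemma degree_eq_card_neighbours: "Defs.degree V E u = card (neighbours V E u)"
  by (simp add: Defs.degree_def neighbours_def)

lemma finite_neighbours: "finite_graph V E \<Longrightarrow> finite (neighbours V E u)"
  by (simp add: finite_graph_def neighbours_def)

lemma degree_pos: "finite_graph V E \<Longrightarrow> E u v \<Longrightarrow> Defs.degree V E u > 0"
  by (auto simp: degree_eq_card_neighbours card_gt_0_iff finite_neighbours)
    (auto simp: neighbours_def finite_graph_def)

lemma sum_neighbours_swap:
  assumes "finite_graph V E"
  shows "(\<Sum>y\<in>V. \<Sum>x\<in>neighbours V E y. f x y) = (\<Sum>x\<in>V. \<Sum>y\<in>neighbours V E x. f x y)"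
proof -
  have sym: "E y x \<longleftrightarrow> E x y" for x y
    using assms by (auto simp: finite_graph_def)
  show ?thesis
    unfolding neighbours_def using assms
    by (subst sum.swap_restrict) (auto simp: finite_graph_def sym[of _ _] cong: sum.cong)
qed

text \<open>The ratio \<open>g y / g x\<close> forced in the universal cover of the graph when
  \<open>\<lambda> d(u) g(u) = \<Sum>\<^bsub>z ~ u\<^esub> g(z)\<close> holds from \<open>y\<close> onwards (away from \<open>x\<close>) and \<open>g\<close> vanishes \<open>k\<close> steps
  beyond \<open>y\<close>.\<close>

fun edge_ratio :: "'a set \<Rightarrow> ('a \<Rightarrow> 'a \<Rightarrow> bool) \<Rightarrow> real \<Rightarrow> nat \<Rightarrow> 'a \<Rightarrow> 'a \<Rightarrow> real" where
  "edge_ratio V E l 0 x y = 0"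
| "edge_ratio V E l (Suc k) x y =
    1 / (l * Defs.degree V E y - (\<Sum>z\<in>neighbours V E y - {x}. edge_ratio V E l k y z))"

text \<open>Neighbours outside the ball are dropped, as for zero boundary values. At an isolated
  vertex the strict inequality would read \<open>0 < 0\<close>, hence the guard on the
  degree.\<close>

definition ball_supersolution ::
    "'a set \<Rightarrow> ('a \<Rightarrow> 'a \<Rightarrow> bool) \<Rightarrow> real \<Rightarrow> 'a \<Rightarrow> nat \<Rightarrow> ('a \<Rightarrow> real) \<Rightarrow> bool" where
  "ball_supersolution V E l v r g \<longleftrightarrow>
    (\<forall>x\<in>ball_vertices V E v r. Defs.degree V E x > 0 \<longrightarrow> g x > 0 \<and>
      (\<Sum>u\<in>neighbours V E x \<inter> ball_vertices V E v r. g u) < l * Defs.degree V E x * g x)"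

text \<open>With \<open>g u = h u / sqrt (d u)\<close> the weight is absorbed:
  \<open>w0 V E x u * h u = g u / sqrt (d x)\<close>.\<close>

lemma ball_supersolution_exists:
  assumes G: "finite_graph V E"
    and l: "spectral_radius_w (ball_vertices V E v r) (ball_edges V E v r) (w0 V E) < l" "l > 0"
  shows "\<exists>g. ball_supersolution V E l v r g"
proof -
  let ?B = "ball_vertices V E v r"
  define d where "d u = real (Defs.degree V E u)" for u
  have finB: "finite ?B" using G by (auto simp: ball_vertices_def finite_graph_def)
  have "w0 V E u v \<ge> 0" for u v by (simp add: w0_def)
  then obtain h where h: "\<And>x. x \<in> ?B \<Longrightarrow> h x > 0"
    "\<And>x. x \<in> ?B \<Longrightarrow>
      (\<Sum>u\<in>?B. (if ball_edges V E v r x u then w0 V E x u else 0) * h u) < l * h x"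
    using positive_supersolution_exists[OF finB _ l] by blast
  define g where "g u = h u / sqrt (d u)" for u
  have "g x > 0 \<and> (\<Sum>u\<in>neighbours V E x \<inter> ?B. g u) < l * d x * g x"
    if x: "x \<in> ?B" "d x > 0" for x
  proof -
    have "(\<Sum>u\<in>?B. (if ball_edges V E v r x u then w0 V E x u else 0) * h u) =
        (\<Sum>u\<in>neighbours V E x \<inter> ?B. g u / sqrt (d x))"
      using finB x(1)
      by (intro sum.mono_neutral_cong_right)
        (auto simp: ball_edges_def neighbours_def ball_vertices_def w0_def g_def d_def
          real_sqrt_mult)
    also have "\<dots> = (\<Sum>u\<in>neighbours V E x \<inter> ?B. g u) / sqrt (d x)"
      by (rule sum_divide_distrib[symmetric])
    finally have "(\<Sum>u\<in>neighbours V E x \<inter> ?B. g u) < l * (h x * sqrt (d x))"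
      using h(2)[OF x(1)] x(2) by (simp add: pos_divide_less_eq mult.assoc)
    also have "h x * sqrt (d x) = d x * g x"
      using real_sqrt_mult_self[of "d x"] x(2) by (simp add: g_def field_simps del: real_sqrt_mult_self)
    finally show ?thesis
      using h(1)[OF x(1)] x(2) by (simp add: g_def mult.assoc)
  qed
  then show ?thesis
    unfolding ball_supersolution_def d_def by auto
qed

text \<open>Induction on \<open>k\<close>: the supersolution property at \<open>y\<close>, with the
  ratios towards the other neighbours bounded below, shows that the denominator of
  \<open>edge_ratio\<close> exceeds \<open>g x / g y > 0\<close>. The distance \<open>r - k\<close>
  leaves room for \<open>k\<close> further steps inside the ball. At \<open>k = 0\<close> the vertex
  \<open>y\<close> may lie outside, where nothing is known about \<open>g\<close>.\<close>

lemma edge_ratio_bounds: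
  assumes G: "finite_graph V E"
    and g: "ball_supersolution V E l v r g"
    and "k \<le> r" "within_dist E v (r - k) x" "E x y"
  shows "if k = 0 then edge_ratio V E l k x y = 0
    else 0 < edge_ratio V E l k x y \<and> edge_ratio V E l k x y < g y / g x"
  using assms(3-)
proof (induction k arbitrary: x y)
  case (Suc k)
  let ?B = "ball_vertices V E v r"
  have edge: "E a b \<Longrightarrow> a \<in> V \<and> b \<in> V \<and> E b a" for a b
    using G by (auto simp: finite_graph_def)
  have wy: "within_dist E v (r - k) y"
    using within_dist_step[OF Suc.prems(2,3)] Suc.prems(1) by (simp add: Suc_diff_Suc)
  have B: "x \<in> ?B" "y \<in> ?B"
    using edge[OF Suc.prems(3)] within_dist_mono[OF Suc.prems(2)] within_dist_mono[OF wy]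
    by (auto simp: ball_vertices_def)
  have dx: "Defs.degree V E x > 0" and dy: "Defs.degree V E y > 0"
    using degree_pos[OF G Suc.prems(3)] degree_pos[OF G, of y x] edge[OF Suc.prems(3)] by auto
  have gx: "g x > 0" and gy: "g y > 0"
    and super: "(\<Sum>u\<in>neighbours V E y \<inter> ?B. g u) < l * Defs.degree V E y * g y"
    using g B dx dy unfolding ball_supersolution_def by auto
  have gpos: "g z > 0" if "z \<in> neighbours V E y \<inter> ?B" for z
    using g that degree_pos[OF G, of z y] edge[of y z]
    by (auto simp: ball_supersolution_def neighbours_def)
  let ?S = "\<Sum>z\<in>neighbours V E y - {x}. edge_ratio V E l k y z"
  \<comment> \<open>For \<open>k = 0\<close> neighbours of \<open>y\<close> may leave the ball, but
    then all ratios in \<open>?S\<close> are 0. For \<open>k > 0\<close> every neighbour of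
    \<open>y\<close> lies in the ball.\<close>
  have "?S * g y \<le> (\<Sum>z\<in>neighbours V E y \<inter> ?B - {x}. g z)"
  proof (cases "k = 0")
    case True
    then show ?thesis by (auto intro!: sum_nonneg less_imp_le[OF gpos])
  next
    case False
    have sub: "neighbours V E y \<subseteq> ?B"
    proof
      fix z assume z: "z \<in> neighbours V E y"
      then have "within_dist E v (Suc (r - k)) z"
        using within_dist_step[OF wy] by (auto simp: neighbours_def)
      then have "within_dist E v r z"
        using False Suc.prems(1) by (elim within_dist_mono) auto
      with z show "z \<in> ?B" by (auto simp: neighbours_def ball_vertices_def)
    qed
    have "edge_ratio V E l k y z * g y \<le> g z" if "z \<in> neighbours V E y" for z
      using Suc.IH[OF _ wy, of z] Suc.prems(1) False that gy
      by (auto simp: neighbours_def pos_less_divide_eq)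
    then show ?thesis
      using sub by (auto simp: sum_distrib_right Int_absorb2 intro!: sum_mono)
  qed
  moreover have "(\<Sum>u\<in>neighbours V E y \<inter> ?B. g u) =
      g x + (\<Sum>z\<in>neighbours V E y \<inter> ?B - {x}. g z)"
    using B(1) edge[OF Suc.prems(3)] finite_neighbours[OF G, of y]
    by (intro sum.remove) (auto simp: neighbours_def)
  ultimately have "g x < (l * Defs.degree V E y - ?S) * g y"
    using super by (simp add: algebra_simps)
  then have D: "g x / g y < l * Defs.degree V E y - ?S"
    using gy by (simp add: pos_divide_less_eq)
  moreover have "g x / g y > 0" using gx gy by simp
  ultimately have "0 < l * Defs.degree V E y - ?S" by linarith
  with D show ?case
    using gx gy by (simp add: field_simps)
qed simp

text \<open>The supersolution inequality at the centre is divided by \<open>g v\<close>. At the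
  centre the index \<open>k = r\<close> is available, its distance bound \<open>r - k\<close> being
  0.\<close>

lemma sum_edge_ratio_root_less:
  assumes G: "finite_graph V E"
    and g: "ball_supersolution V E l v r g"
    and r: "r \<ge> 1" and v: "v \<in> V" "Defs.degree V E v > 0"
  shows "(\<Sum>z\<in>neighbours V E v. edge_ratio V E l r v z) < l * Defs.degree V E v"
proof -
  let ?B = "ball_vertices V E v r"
  have vB: "v \<in> ?B"
    using v within_dist_mono[of E v 0 v r] by (simp add: ball_vertices_def)
  have sub: "neighbours V E v \<inter> ?B = neighbours V E v"
    using within_dist_mono[OF within_dist_step[of E v 0 v], of _ r] r
    by (auto simp: ball_vertices_def neighbours_def)
  have gv: "g v > 0" and super: "(\<Sum>u\<in>neighbours V E v. g u) < l * Defs.degree V E v * g v"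
    using bspec[OF g[unfolded ball_supersolution_def] vB] v(2) unfolding sub by auto
  have "(\<Sum>z\<in>neighbours V E v. edge_ratio V E l r v z) \<le> (\<Sum>z\<in>neighbours V E v. g z / g v)"
    using edge_ratio_bounds[OF G g, of r v] r
    by (intro sum_mono less_imp_le) (auto simp: neighbours_def)
  also have "\<dots> < l * Defs.degree V E v"
    using super gv by (simp add: pos_divide_less_eq flip: sum_divide_distrib)
  finally show ?thesis .
qed

section \<open>Summation over directed edges and conclusion\<close>

text \<open>The edge ratios do not depend on a ball, so bounds obtained from different balls can be
  summed over the whole graph. The vertex \<open>v0\<close> makes the sum strict.\<close>

lemma second_moment_degree_lower_bound:
  assumes G: "finite_graph V E"
    and r: "r \<ge> 1" and l: "l > 0"
    and sr: "\<And>v. v \<in> V \<Longrightarrow>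
      spectral_radius_w (ball_vertices V E v r) (ball_edges V E v r) (w0 V E) < l"
    and e: "v0 \<in> V" "Defs.degree V E v0 > 0"
  defines "d \<equiv> \<lambda>u. real (Defs.degree V E u)"
  shows "2 * cos (pi / (real r + 2)) * (\<Sum>u\<in>V. d u * sqrt (d u - 1)) < l * (\<Sum>u\<in>V. (d u)\<^sup>2)"
proof -
  define N where "N = neighbours V E"
  define m where "m = edge_ratio V E l"
  have finV: "finite V" using G by (simp add: finite_graph_def)
  have finN: "finite (N u)" for u using finite_neighbours[OF G] by (simp add: N_def)
  have card: "real (card (N u)) = d u" for u
    by (simp add: N_def d_def degree_eq_card_neighbours)
  have super: "\<exists>g. ball_supersolution V E l v r g" if "v \<in> V" for v
    using ball_supersolution_exists[OF G sr[OF that] l] .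
  have mpos: "m k x y > 0" if k: "1 \<le> k" "k \<le> r" and x: "x \<in> V" "y \<in> N x" for k x y
  proof -
    obtain g where g: "ball_supersolution V E l x r g" using super[OF x(1)] by blast
    have "within_dist E x (r - k) x" using within_dist_mono[of E x 0 x] by simp
    then show ?thesis
      using edge_ratio_bounds[OF G g k(2), of x y] k x by (auto simp: m_def N_def neighbours_def)
  qed
  have d1: "d x \<ge> 1" if "y \<in> N x" for x y
    using degree_pos[OF G, of x y] that by (auto simp: d_def N_def neighbours_def)
  define S where "S = (\<Sum>u\<in>V. (d u)\<^sup>2)"
  define X where "X = (\<Sum>u\<in>V. d u * sqrt (d u - 1))"
  define R where "R k = (\<Sum>x\<in>V. \<Sum>y\<in>N x. 1 / m k x y)" for k
  define Q where "Q k = (\<Sum>x\<in>V. (d x - 1) * (\<Sum>y\<in>N x. m k x y))" for k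
  have Q0: "Q 0 = 0" by (simp add: Q_def m_def)
  \<comment> \<open>Inverting twice returns the denominator, even if it is 0, so the identity holds
    for every \<open>k\<close>.\<close>
  have eq: "l * S = R (Suc k) + Q k" for k
  proof -
    have "l * S = (\<Sum>y\<in>V. \<Sum>x\<in>N y. l * d y)"
      by (simp add: S_def sum_distrib_left card power2_eq_square mult_ac)
    also have "\<dots> = (\<Sum>y\<in>V. \<Sum>x\<in>N y. 1 / m (Suc k) x y + (\<Sum>z\<in>N y - {x}. m k y z))"
      by (simp add: m_def N_def d_def)
    also have "\<dots> = (\<Sum>y\<in>V. \<Sum>x\<in>N y. 1 / m (Suc k) x y) + Q k"
      by (simp add: sum.distrib sum_sum_remove1[OF finN] card Q_def)
    also have "(\<Sum>y\<in>V. \<Sum>x\<in>N y. 1 / m (Suc k) x y) = R (Suc k)"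
      unfolding N_def R_def by (rule sum_neighbours_swap[OF G])
    finally show ?thesis .
  qed
  \<comment> \<open>Substitute for \<open>eq\<close> at \<open>k = r\<close>, where the sign of
    \<open>R (Suc r)\<close> is unknown: the inequality at each centre is multiplied by
    \<open>d x\<close>, then \<open>d x\<close> is lowered to \<open>d x - 1\<close> on the
    left.\<close>
  have root: "Q r < l * S"
  proof -
    have le: "(d x - 1) * (\<Sum>y\<in>N x. m r x y) \<le> l * (d x)\<^sup>2"
      and less: "d x > 0 \<Longrightarrow> (d x - 1) * (\<Sum>y\<in>N x. m r x y) < l * (d x)\<^sup>2" if x: "x \<in> V" for x
    proof -
      have M: "(\<Sum>y\<in>N x. m r x y) \<ge> 0"
        using mpos[of r x] r x by (intro sum_nonneg less_imp_le) auto
      show less: "(d x - 1) * (\<Sum>y\<in>N x. m r x y) < l * (d x)\<^sup>2" if dx: "d x > 0"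
      proof -
        obtain g where "ball_supersolution V E l x r g" using super[OF x] by blast
        then have "(\<Sum>y\<in>N x. m r x y) < l * d x"
          using sum_edge_ratio_root_less[OF G _ r x] dx by (simp add: m_def N_def d_def)
        then have "d x * (\<Sum>y\<in>N x. m r x y) < d x * (l * d x)"
          using dx by simp
        then show ?thesis using M by (simp add: algebra_simps power2_eq_square)
      qed
      show "(d x - 1) * (\<Sum>y\<in>N x. m r x y) \<le> l * (d x)\<^sup>2"
      proof (cases "d x > 0")
        case False
        then have "N x = {}" using d1 by force
        then show ?thesis using l by simp
      qed (use less in auto)
    qed
    show ?thesis
      unfolding Q_def S_def sum_distrib_left[of l]
      using e finV le less by (intro sum_strict_mono_ex1) (auto simp: d_def)
  qed
  define \<theta> where "\<theta> = pi / (real r + 2)"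
  define t where "t k = sin (real k * \<theta>)" for k :: nat
  have tpos: "t (Suc k) > 0" if "k \<le> r" for k
  proof -
    have "real (Suc k) < real r + 2" using that by simp
    then have "real (Suc k) * \<theta> < (real r + 2) * \<theta>"
      by (intro mult_strict_right_mono) (auto simp: \<theta>_def)
    then show ?thesis
      unfolding t_def by (intro sin_gt_zero) (auto simp: \<theta>_def)
  qed
  have step: "2 * t (Suc k) * t (Suc (Suc k)) * X \<le>
      (t (Suc k))\<^sup>2 * R (Suc k) + (t (Suc (Suc k)))\<^sup>2 * Q (Suc k)" if "k < r" for k
  proof -
    have "2 * t (Suc k) * t (Suc (Suc k)) * X =
        (\<Sum>x\<in>V. \<Sum>y\<in>N x. 2 * t (Suc k) * t (Suc (Suc k)) * sqrt (d x - 1))"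
      by (simp add: X_def card sum_distrib_left mult_ac)
    also have "\<dots> \<le> (\<Sum>x\<in>V. \<Sum>y\<in>N x.
        (t (Suc k))\<^sup>2 / m (Suc k) x y + (t (Suc (Suc k)))\<^sup>2 * ((d x - 1) * m (Suc k) x y))"
      using that d1 by (intro sum_mono weighted_am_gm mpos) auto
    also have "\<dots> = (t (Suc k))\<^sup>2 * R (Suc k) + (t (Suc (Suc k)))\<^sup>2 * Q (Suc k)"
      by (simp add: R_def Q_def sum.distrib sum_distrib_left)
    finally show ?thesis .
  qed
  let ?T = "\<Sum>k\<le>r. (t (Suc k))\<^sup>2"
  have "2 * cos \<theta> * ?T * X = (\<Sum>k<r. 2 * t (Suc k) * t (Suc (Suc k))) * X"
    unfolding t_def \<theta>_def sum_sin_consecutive ..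
  also have "\<dots> \<le> (\<Sum>k<r. (t (Suc k))\<^sup>2 * R (Suc k) + (t (Suc (Suc k)))\<^sup>2 * Q (Suc k))"
    unfolding sum_distrib_right using step by (intro sum_mono) auto
  \<comment> \<open>Reindexed, \<open>R (Suc k)\<close> and \<open>Q k\<close> carry the same
    weight, so \<open>eq\<close> applies for \<open>k < r\<close>. The new term at 0 vanishes by
    \<open>Q0\<close>, and \<open>Q r\<close> is left for \<open>root\<close>.\<close>
  also have "\<dots> = (\<Sum>k<r. (t (Suc k))\<^sup>2 * R (Suc k)) + (\<Sum>k<Suc r. (t (Suc k))\<^sup>2 * Q k)"
    unfolding sum.distrib by (subst sum.lessThan_Suc_shift) (simp add: Q0)
  also have "\<dots> = (\<Sum>k<r. (t (Suc k))\<^sup>2 * (l * S)) + (t (Suc r))\<^sup>2 * Q r"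
    by (simp flip: sum.distrib distrib_left eq)
  also have "\<dots> < (\<Sum>k<r. (t (Suc k))\<^sup>2 * (l * S)) + (t (Suc r))\<^sup>2 * (l * S)"
    using root tpos[of r] by simp
  also have "\<dots> = ?T * (l * S)"
    by (simp add: sum_distrib_right distrib_right flip: lessThan_Suc_atMost)
  finally have "?T * (2 * cos \<theta> * X) < ?T * (l * S)"
    by (simp add: mult_ac)
  moreover have "?T \<ge> 0" by (intro sum_nonneg) auto
  ultimately show ?thesis
    unfolding S_def X_def \<theta>_def by (simp add: mult_less_cancel_left)
qed

theorem theorem4p3:
  fixes V :: "'a set" and E :: "'a \<Rightarrow> 'a \<Rightarrow> bool" and r :: nat
  assumes "finite_graph V E"
    and "V \<noteq> {}"
    and "avg_degree V E \<ge> 2"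
    and "r \<ge> 1"
  shows "\<exists>v\<in>V. spectral_radius_w (ball_vertices V E v r) (ball_edges V E v r) (w0 V E)
           \<ge> 2 * sqrt (avg_degree V E - 1) / second_avg_degree V E * cos (pi / (real r + 2))"
proof (rule ccontr)
  define d where "d u = real (Defs.degree V E u)" for u
  define M where "M = (\<Sum>u\<in>V. d u)"
  define S where "S = (\<Sum>u\<in>V. (d u)\<^sup>2)"
  define c where "c = cos (pi / (real r + 2))"
  define s where "s = sqrt (avg_degree V E - 1)"
  define l where "l = 2 * s / second_avg_degree V E * c"
  assume "\<not> ?thesis"
  then have sr: "spectral_radius_w (ball_vertices V E v r) (ball_edges V E v r) (w0 V E) < l"
    if "v \<in> V" for v
    using that by (force simp: l_def s_def c_def)
  have finV: "finite V" using assms(1) by (simp add: finite_graph_def)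
  have "0 < avg_degree V E * card V"
    using finV assms(2,3) by (simp add: card_gt_0_iff)
  also have "\<dots> = M"
    using finV assms(2) by (simp add: avg_degree_def M_def d_def)
  finally have M: "M > 0" .
  then obtain v0 where v0: "v0 \<in> V" "d v0 > 0"
    unfolding M_def by (metis linorder_not_less sum_nonpos)
  have "0 < (d v0)\<^sup>2" using v0 by simp
  also have "\<dots> \<le> S" unfolding S_def using v0 finV by (intro member_le_sum) auto
  finally have S: "S > 0" .
  have c: "c > 0"
  proof -
    have "pi / (real r + 2) < pi / 2"
      using assms(4) by (intro divide_strict_left_mono) auto
    moreover have "pi / (real r + 2) > - (pi / 2)"
      by (rule less_le_trans[of _ 0]) auto
    ultimately show ?thesis unfolding c_def by (intro cos_gt_zero_pi) auto
  qed
  have s: "s > 0" using assms(3) by (simp add: s_def)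
  \<comment> \<open>Since the second order average degree is \<open>S / M\<close>, the bound on
    \<open>l * S\<close> below becomes one on \<open>M * s\<close>, to be contradicted by the
    tangent inequality.\<close>
  have l_eq: "l = 2 * c * (M * s) / S"
    by (simp add: l_def second_avg_degree_def M_def S_def d_def)
  then have "l > 0" using c M s S by simp
  then have "2 * c * (\<Sum>u\<in>V. d u * sqrt (d u - 1)) < l * S"
    using second_moment_degree_lower_bound[OF assms(1,4) _ sr v0(1)] v0(2)
    by (simp add: c_def S_def d_def)
  also have "l * S = 2 * c * (M * s)"
    using S by (simp add: l_eq)
  finally have "(\<Sum>u\<in>V. d u * sqrt (d u - 1)) < M * s"
    using c by simp
  moreover have "M * s \<le> (\<Sum>u\<in>V. d u * sqrt (d u - 1))"
    unfolding M_def s_def d_def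
    by (intro sum_mult_sqrt_pred_ge finV assms(2,3)) (simp add: avg_degree_def)
  ultimately show False by simp
qed

end
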